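(* Let $R\to S$ be a purely inseparable extension of rings of prime characteristic $p>0$ with finite pure inseparability index $e_0$, and let $I$ and $J$ be ideals of $R$ and $S$ respectively. Then \[ \operatorname{Fte} I\le \operatorname{Fte} IS+e_0 \quad\text{and}\quad \operatorname{Fte} J\le \operatorname{Fte} F^{e_0}(J)R+e_0 . \] In particular, if $(R,\mathfrak m)$ and $(S,\mathfrak n)$ are local, then \[ \operatorname{Fte} R\le \operatorname{Fte} S+e_0\quad\text{and}\quad \operatorname{Fte} S\le\operatorname{Fte} R+e_0 . \]
   Context: All rings are commutative with identity and Noetherian. An injective ring homomorphism $R\to S$ (viewed as an inclusion) of rings of characteristic $p$ is a purely inseparable extension if for every $s\in S$ there is a natural number $e$ with $s^{p^e}\in R$. Its pure inseparability index is the smallest $e$ (if one exists) such that $F^e(S)=\{s^{p^e}\mid s\in S\}\subset R$. $F^{e_0}(J)R$ denotes the ideal of $R$ generated by $\{y^{p^{e_0}}\mid y\in J\}$. For an ideal $I$ of a ring $A$ of characteristic $p$, $I^{[p^e]}$ is the ideal generated by the $p^e$-th powers of elements of $I$, and $I^F=\{x\in A\mid x^{p^e}\in I^{[p^e]}\text{ for some }e\ge0\}$. $\operatorname{Fte} I$ is the smallest $e\ge 0$ such that $x^{p^e}\in I^{[p^e]}$ for all $x\in I^F$; here $\operatorname{Fte}$ of an ideal is computed in the ring of which it is an ideal. A parameter ideal of a local ring is an ideal generated by a (partial) system of parameters, and for a local ring $A$, $\operatorname{Fte} A=\sup\{\operatorname{Fte}\mathfrak q\mid\mathfrak q\subset A\text{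 a parameter ideal}\}\in\mathbb N\cup\{\infty\}$. *)

theory Defs
  imports
    "HOL-Algebra.Ideal"
    "HOL-Algebra.RingHom"
    "HOL-Algebra.Ring_Divisibility"
    "HOL-Computational_Algebra.Primes"
    "HOL-Library.Extended_Nat"
begin

text \<open>Rings are HOL-Algebra records. A ring extension of \<open>R\<close> by \<open>S\<close> is an injective
  homomorphism \<open>\<phi>\<close>, so that ``lies in \<open>R\<close>'' reads ``lies in \<open>\<phi> ` carrier R\<close>''. Quantities that may
  be infinite, or may fail to exist, take values in \<^typ>\<open>enat\<close>; note \<open>Inf {} = \<infinity>\<close> there.\<close>

subsection \<open>Characteristic\<close>

text \<open>For \<open>p \<noteq> 1\<close> this excludes the zero ring.\<close>

definition has_characteristic :: "('a, 'm) ring_scheme \<Rightarrow> nat \<Rightarrow> bool" where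
  "has_characteristic R p \<longleftrightarrow>
     (\<forall>n::nat. add_pow R n \<one>\<^bsub>R\<^esub> = \<zero>\<^bsub>R\<^esub> \<longleftrightarrow> p dvd n)"

subsection \<open>Purely inseparable extensions\<close>

definition purely_inseparable ::
    "nat \<Rightarrow> ('a, 'm) ring_scheme \<Rightarrow> ('b, 'n) ring_scheme \<Rightarrow> ('a \<Rightarrow> 'b) \<Rightarrow> bool" where
  "purely_inseparable p R S \<phi> \<longleftrightarrow>
     \<phi> \<in> ring_hom R S \<and> inj_on \<phi> (carrier R) \<and>
     (\<forall>s\<in>carrier S. \<exists>e::nat. s [^]\<^bsub>S\<^esub> (p ^ e) \<in> \<phi> ` carrier R)"

definition pure_insep_index ::
    "nat \<Rightarrow> ('a, 'm) ring_scheme \<Rightarrow> ('b, 'n) ring_scheme \<Rightarrow> ('a \<Rightarrow> 'b) \<Rightarrow> enat" where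
  "pure_insep_index p R S \<phi> =
     (INF e \<in> {e::nat. (\<lambda>s. s [^]\<^bsub>S\<^esub> (p ^ e)) ` carrier S \<subseteq> \<phi> ` carrier R}. enat e)"

definition extended_ideal :: "('b, 'n) ring_scheme \<Rightarrow> ('a \<Rightarrow> 'b) \<Rightarrow> 'a set \<Rightarrow> 'b set" where
  "extended_ideal S \<phi> I = genideal S (\<phi> ` I)"

text \<open>The ideal \<open>F\<^sup>e(J)R\<close> of \<open>R\<close>. It is the intended ideal when \<open>e\<close> is at least the pure
  inseparability index, so that every \<open>p\<^sup>e\<close>-th power of an element of \<open>J\<close> lies in the image of
  \<open>R\<close>.\<close>

definition frobenius_image_ideal ::
    "nat \<Rightarrow> ('a, 'm) ring_scheme \<Rightarrow> ('b, 'n) ring_scheme \<Rightarrow> ('a \<Rightarrow> 'b) \<Rightarrow> nat \<Rightarrow> 'b set \<Rightarrow> 'a set" where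
  "frobenius_image_ideal p R S \<phi> e J =
     genideal R {r \<in> carrier R. \<exists>y\<in>J. \<phi> r = y [^]\<^bsub>S\<^esub> (p ^ e)}"

subsection \<open>Frobenius test exponent of an ideal\<close>

definition frobenius_power :: "nat \<Rightarrow> ('a, 'm) ring_scheme \<Rightarrow> nat \<Rightarrow> 'a set \<Rightarrow> 'a set" where
  "frobenius_power p A e I = genideal A ((\<lambda>x. x [^]\<^bsub>A\<^esub> (p ^ e)) ` I)"

definition frobenius_closure :: "nat \<Rightarrow> ('a, 'm) ring_scheme \<Rightarrow> 'a set \<Rightarrow> 'a set" where
  "frobenius_closure p A I =
     {x \<in> carrier A. \<exists>e::nat. x [^]\<^bsub>A\<^esub> (p ^ e) \<in> frobenius_power p A e I}"

definition Fte :: "nat \<Rightarrow> ('a, 'm) ring_scheme \<Rightarrow> 'a set \<Rightarrow> enat" where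
  "Fte p A I =
     (INF e \<in> {e::nat. \<forall>x\<in>frobenius_closure p A I.
                  x [^]\<^bsub>A\<^esub> (p ^ e) \<in> frobenius_power p A e I}. enat e)"

subsection \<open>Local rings and parameter ideals\<close>

definition local_ring :: "('a, 'm) ring_scheme \<Rightarrow> 'a set \<Rightarrow> bool" where
  "local_ring A \<mm> \<longleftrightarrow>
     cring A \<and> maximalideal \<mm> A \<and> (\<forall>M. maximalideal M A \<longrightarrow> M = \<mm>)"

definition krull_dim :: "('a, 'm) ring_scheme \<Rightarrow> enat" where
  "krull_dim A =
     (SUP n \<in> {n::nat. \<exists>P. (\<forall>i\<le>n. primeideal (P i) A) \<and> (\<forall>i<n. P i \<subset> P (Suc i))}. enat n)"

definition radical_ideal :: "('a, 'm) ring_scheme \<Rightarrow> 'a set \<Rightarrow> 'a set" where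
  "radical_ideal A I = {x \<in> carrier A. \<exists>n::nat. x [^]\<^bsub>A\<^esub> n \<in> I}"

text \<open>An ideal whose radical is the maximal ideal \<open>\<mm>\<close> is automatically \<open>\<mm>\<close>-primary.\<close>

definition system_of_parameters :: "('a, 'm) ring_scheme \<Rightarrow> 'a set \<Rightarrow> 'a list \<Rightarrow> bool" where
  "system_of_parameters A \<mm> xs \<longleftrightarrow>
     set xs \<subseteq> \<mm> \<and> enat (length xs) = krull_dim A \<and>
     radical_ideal A (genideal A (set xs)) = \<mm>"

text \<open>Partial systems of parameters are the initial segments of systems of parameters, the empty
  one (generating the zero ideal) and the full one included.\<close>

definition parameter_ideal :: "('a, 'm) ring_scheme \<Rightarrow> 'a set \<Rightarrow> 'a set \<Rightarrow> bool" where
  "parameter_ideal A \<mm> \<qq> \<longleftrightarrow>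
     (\<exists>xs ys. system_of_parameters A \<mm> (xs @ ys) \<and> \<qq> = genideal A (set xs))"

definition Fte_ring :: "nat \<Rightarrow> ('a, 'm) ring_scheme \<Rightarrow> 'a set \<Rightarrow> enat" where
  "Fte_ring p A \<mm> = (SUP \<qq> \<in> {\<qq>. parameter_ideal A \<mm> \<qq>}. Fte p A \<qq>)"

end

theory Submission
  imports Defs
begin

text \<open>
  Let \<open>F\<close> denote the \<open>p\<close>-th power map. Since \<open>S\<close> has index \<open>e\<^sub>0\<close> over \<open>R\<close>, the iterate \<open>F\<^sup>e\<close> with
  \<open>e = e\<^sub>0\<close> maps \<open>S\<close> into \<open>\<phi>(R)\<close>, and \<open>\<phi>\<close> is injective, so \<open>\<psi> = \<phi>\<inverse> \<circ> F\<^sup>e\<close> is a ring homomorphism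
  from \<open>S\<close> to \<open>R\<close>. Then \<open>\<phi> \<circ> \<psi>\<close> and \<open>\<psi> \<circ> \<phi>\<close> are both equal to \<open>F\<^sup>e\<close>, on \<open>S\<close> and on \<open>R\<close>. Moreover
  the ideal \<open>F\<^sup>e(J)R\<close> is just the extension of \<open>J\<close> along \<open>\<psi>\<close>. Hence \<open>\<phi>\<close> and \<open>\<psi>\<close> play symmetric
  roles, and each pair of inequalities is one inequality used twice.

  For that inequality, let \<open>f : A \<rightarrow> B\<close> and \<open>g : B \<rightarrow> A\<close> satisfy \<open>g \<circ> f = F\<^sup>e\<close>, and let \<open>k\<close> be a test
  exponent for the extended ideal \<open>IB\<close>. If \<open>x\<close> lies in the Frobenius closure of \<open>I\<close>, then \<open>f x\<close> lies
  in that of \<open>IB\<close>, so \<open>F\<^sup>k(f x) = f(F\<^sup>k x)\<close> is a \<open>B\<close>-linear combination of the \<open>f(F\<^sup>k a)\<close> with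
  \<open>a \<in> I\<close>. Applying \<open>g\<close> writes \<open>F\<^bsup>k+e\<^esup> x\<close> as an \<open>A\<close>-linear combination of the \<open>F\<^bsup>k+e\<^esup> a\<close>. Thus \<open>k + e\<close> is
  a test exponent for \<open>I\<close> (\<open>Fte_le_Fte_extended_ideal\<close>).
  The only other ingredient is that a Frobenius power of an ideal can be computed on generators (\<open>frobenius_power_genideal\<close>), which holds because the
  Frobenius map is a ring homomorphism.

  In the local case it remains to see that extension along \<open>f\<close> takes parameter ideals to parameter
  ideals. Since \<open>f \<circ> g\<close> and \<open>g \<circ> f\<close> are iterates of Frobenius, and the preimage of a
  prime ideal under such an iterate is that prime itself, contraction along \<open>f\<close> and \<open>g\<close> identifies the
  prime ideals of \<open>A\<close> and \<open>B\<close>. So the dimensions agree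
  and the maximal ideals contract to each other, and a power of an element \<open>s\<close> of the
  maximal ideal of \<open>B\<close> lies in the ideal generated by \<open>f(xs)\<close> because a power of \<open>g s\<close> lies in the
  one generated by \<open>xs\<close> (\<open>system_of_parameters_map\<close>).
\<close>

section \<open>The Frobenius homomorphism\<close>

lemma (in cring) binomial_theorem:
  fixes n :: nat
  assumes x: "x \<in> carrier R" and y: "y \<in> carrier R"
  shows "(x \<oplus> y) [^] n = (\<Oplus>k\<in>{..n}. [(n choose k)] \<cdot> (x [^] k \<otimes> y [^] (n - k)))"
proof (induction n)
  case 0
  show ?case using x y by simp
next
  case (Suc n)
  let ?t = "\<lambda>k. [(n choose k)] \<cdot> (x [^] k \<otimes> y [^] (n - k))"
  let ?u = "\<lambda>k. [(n choose k)] \<cdot> (x [^] k \<otimes> y [^] (Suc n - k))"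
  let ?v = "\<lambda>k. [(Suc n choose k)] \<cdot> (x [^] k \<otimes> y [^] (Suc n - k))"
  have t: "?t \<in> X \<rightarrow> carrier R" and u: "?u \<in> X \<rightarrow> carrier R" and v: "?v \<in> X \<rightarrow> carrier R"
    for X :: "nat set"
    using x y by auto
  have shift_x: "?t k \<otimes> x = [(n choose k)] \<cdot> (x [^] Suc k \<otimes> y [^] (n - k))" for k
    using x y by (simp add: add_pow_ldistr add_pow_rdistr m_ac)
  have shift_y: "?t k \<otimes> y = ?u k" if "k \<le> n" for k
    using x y that by (simp add: add_pow_ldistr m_assoc Suc_diff_le)
  \<comment> \<open>The term \<open>k = Suc n\<close> of \<open>?u\<close> vanishes, so the sum may be extended to it and then split off
    its first term; this prepares for Pascal's rule.\<close>
  have "finsum R ?u {..n} = finsum R ?u {..Suc n}"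
    using x y u by (simp add: binomial_eq_0)
  also have "\<dots> = (\<Oplus>k\<in>{..n}. ?u (Suc k)) \<oplus> ?u 0"
    by (rule finsum_Suc2[OF u])
  finally have split_u: "finsum R ?u {..n} = (\<Oplus>k\<in>{..n}. ?u (Suc k)) \<oplus> ?u 0" .
  have pascal: "?t k \<otimes> x \<oplus> ?u (Suc k) = ?v (Suc k)" for k
    using x y by (simp add: shift_x add.nat_pow_mult)
  have "(x \<oplus> y) [^] Suc n = finsum R ?t {..n} \<otimes> (x \<oplus> y)"
    using Suc.IH by simp
  also have "\<dots> = finsum R ?t {..n} \<otimes> x \<oplus> finsum R ?t {..n} \<otimes> y"
    using x y t by (intro r_distr finsum_closed) auto
  also have "finsum R ?t {..n} \<otimes> x = (\<Oplus>k\<in>{..n}. ?t k \<otimes> x)"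
    using x t by (intro finsum_ldistr) auto
  also have "finsum R ?t {..n} \<otimes> y = (\<Oplus>k\<in>{..n}. ?t k \<otimes> y)"
    using y t by (intro finsum_ldistr) auto
  also have "\<dots> = finsum R ?u {..n}"
    using u shift_y by (intro finsum_cong') auto
  also have "(\<Oplus>k\<in>{..n}. ?t k \<otimes> x) \<oplus> finsum R ?u {..n}
      = ((\<Oplus>k\<in>{..n}. ?t k \<otimes> x) \<oplus> (\<Oplus>k\<in>{..n}. ?u (Suc k))) \<oplus> ?u 0"
    unfolding split_u using x y by (intro a_assoc[symmetric] finsum_closed) auto
  also have "(\<Oplus>k\<in>{..n}. ?t k \<otimes> x) \<oplus> (\<Oplus>k\<in>{..n}. ?u (Suc k))
      = (\<Oplus>k\<in>{..n}. ?t k \<otimes> x \<oplus> ?u (Suc k))"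
    using x y by (intro finsum_addf[symmetric]) auto
  also have "\<dots> = (\<Oplus>k\<in>{..n}. ?v (Suc k))"
    by (simp only: pascal)
  also have "\<dots> \<oplus> ?u 0 = (\<Oplus>k\<in>{..n}. ?v (Suc k)) \<oplus> ?v 0"
    by simp
  also have "\<dots> = finsum R ?v {..Suc n}"
    by (rule finsum_Suc2[OF v, symmetric])
  finally show ?case .
qed

locale prime_char_cring = cring +
  fixes p :: nat
  assumes prime_p: "prime p"
    and add_pow_p_one: "[p] \<cdot> \<one> = \<zero>"
begin

lemma add_pow_eq_zero_if_dvd:
  assumes "p dvd n" and "x \<in> carrier R"
  shows "[n] \<cdot> x = \<zero>"
proof -
  obtain c where n: "n = p * c" using assms(1) by blast
  have "[p] \<cdot> x = ([p] \<cdot> \<one>) \<otimes> x"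
    using assms(2) by (simp add: add_pow_ldistr)
  then have "[p] \<cdot> x = \<zero>"
    using assms(2) by (simp add: add_pow_p_one)
  then have "[c] \<cdot> ([p] \<cdot> x) = \<zero>" by simp
  then show ?thesis
    using assms(2) by (simp add: n add.nat_pow_pow)
qed

text \<open>All binomial coefficients except the two outer ones are divisible by \<open>p\<close>.\<close>

lemma freshmans_dream:
  assumes x: "x \<in> carrier R" and y: "y \<in> carrier R"
  shows "(x \<oplus> y) [^] p = x [^] p \<oplus> y [^] p"
proof -
  obtain l where p: "p = Suc (Suc l)"
    using prime_p prime_ge_2_nat by (metis add_2_eq_Suc le_Suc_ex)
  let ?t = "\<lambda>k. [(p choose k)] \<cdot> (x [^] k \<otimes> y [^] (p - k))"
  have t: "?t \<in> X \<rightarrow> carrier R" for X :: "nat set"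
    using x y by auto
  have middle: "?t (Suc k) = \<zero>" if "k \<le> l" for k
    using x y prime_p that p by (intro add_pow_eq_zero_if_dvd dvd_choose_prime) auto
  have "(x \<oplus> y) [^] p = finsum R ?t {..Suc (Suc l)}"
    using binomial_theorem[OF x y, of p] p by simp
  also have "\<dots> = ?t p \<oplus> finsum R ?t {..Suc l}"
    using finsum_Suc[OF t, of "Suc l"] by (simp only: p[symmetric])
  also have "finsum R ?t {..Suc l} = (\<Oplus>k\<in>{..l}. ?t (Suc k)) \<oplus> ?t 0"
    by (rule finsum_Suc2[OF t])
  also have "(\<Oplus>k\<in>{..l}. ?t (Suc k)) = (\<Oplus>k\<in>{..l}. \<zero>)"
    using middle by (intro finsum_cong') auto
  finally show ?thesis
    using x y by simp
qed

lemma frobenius_ring_hom: "ring_hom_ring R R (\<lambda>x. x [^] (p ^ e))"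
proof (intro ring_hom_ringI)
  fix x y assume xy: "x \<in> carrier R" "y \<in> carrier R"
  show "(x \<oplus> y) [^] (p ^ e) = x [^] (p ^ e) \<oplus> y [^] (p ^ e)"
  proof (induction e)
    case (Suc e)
    have "(x \<oplus> y) [^] (p ^ Suc e) = ((x \<oplus> y) [^] (p ^ e)) [^] p"
      using xy by (simp add: nat_pow_pow mult.commute)
    also have "\<dots> = (x [^] (p ^ e)) [^] p \<oplus> (y [^] (p ^ e)) [^] p"
      using xy by (simp add: Suc.IH freshmans_dream)
    also have "\<dots> = x [^] (p ^ Suc e) \<oplus> y [^] (p ^ Suc e)"
      using xy by (simp add: nat_pow_pow mult.commute)
    finally show ?case .
  qed (use xy in simp)
qed (auto intro: nat_pow_distrib ring_axioms)

end

section \<open>Extension of ideals along a homomorphism\<close>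

lemma (in ring_hom_ring) hom_mem_genideal:
  assumes "X \<subseteq> carrier R" and "a \<in> genideal R X"
  shows "h a \<in> genideal S (h ` X)"
proof -
  have hX: "h ` X \<subseteq> carrier S" using assms(1) by auto
  have "genideal R X \<subseteq> {r \<in> carrier R. h r \<in> genideal S (h ` X)}"
    using assms(1) S.genideal_self[OF hX]
    by (intro R.genideal_minimal ideal_vimage S.genideal_ideal hX) auto
  then show ?thesis using assms(2) by auto
qed

lemma (in ring_hom_ring) genideal_image_genideal:
  assumes "X \<subseteq> carrier R"
  shows "genideal S (h ` genideal R X) = genideal S (h ` X)"
proof
  have hX: "h ` X \<subseteq> carrier S" using assms by auto
  show "genideal S (h ` genideal R X) \<subseteq> genideal S (h ` X)"
    using assms by (intro S.genideal_minimal S.genideal_ideal hX) (auto intro: hom_mem_genideal)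
  have "h ` genideal R X \<subseteq> carrier S"
    using ideal.Icarr[OF R.genideal_ideal[OF assms]] by auto
  then show "genideal S (h ` X) \<subseteq> genideal S (h ` genideal R X)"
    using R.genideal_self[OF assms] S.genideal_self
    by (intro S.genideal_minimal S.genideal_ideal) blast+
qed

text \<open>The Frobenius power of an ideal is its extension along the Frobenius homomorphism.\<close>

lemma (in prime_char_cring) frobenius_power_genideal:
  assumes "X \<subseteq> carrier R"
  shows "frobenius_power p R e (genideal R X) = genideal R ((\<lambda>x. x [^] (p ^ e)) ` X)"
proof -
  interpret F: ring_hom_ring R R "\<lambda>x. x [^] (p ^ e)" by (rule frobenius_ring_hom)
  show ?thesis
    unfolding frobenius_power_def by (rule F.genideal_image_genideal[OF assms])
qed

lemma (in primeideal) mem_if_pow_mem: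
  fixes n :: nat
  assumes "x \<in> carrier R" and "x [^] n \<in> I"
  shows "x \<in> I"
  using assms(2)
proof (induction n)
  case 0
  then show ?case using one_imp_carrier I_notcarr by simp
next
  case (Suc n)
  then show ?case using I_prime[of "x [^] n" x] assms(1) by auto
qed

lemma (in ideal) pow_mem:
  fixes n :: nat
  assumes "x \<in> I" and "0 < n"
  shows "x [^] n \<in> I"
  using assms by (cases n) (auto intro: I_l_closed Icarr)

text \<open>Both the pure inseparability index and the Frobenius test exponent are infima in \<^typ>\<open>enat\<close>;
  a finite value of such an infimum is attained, by well-ordering.\<close>

lemma INF_enat_attained:
  assumes "(INF k\<in>E. enat k) = enat n"
  shows "n \<in> E"
proof -
  have "enat ` E \<noteq> {}"
  proof
    assume "enat ` E = {}"
    then have "Inf (enat ` E) = \<infinity>" by (simp only: Inf_enat_def if_True refl)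
    then show False using assms by simp
  qed
  then obtain x where "x \<in> enat ` E" by blast
  then have "Inf (enat ` E) \<in> enat ` E" by (rule wellorder_InfI)
  then show ?thesis unfolding assms by (rule imageE) simp
qed

section \<open>Homomorphisms inverse to each other up to Frobenius\<close>

text \<open>The assumptions are symmetric under exchanging \<open>(A, f)\<close> and \<open>(B, g)\<close>; see \<open>flipped\<close> below.
  Every result is therefore stated in one direction only.\<close>

locale frobenius_inverse_pair =
  A: prime_char_cring A p + B: prime_char_cring B p +
  f: ring_hom_ring A B f + g: ring_hom_ring B A g
  for A :: "('a, 'm) ring_scheme" and B :: "('b, 'n) ring_scheme" and p f g +
  fixes d :: nat
  assumes g_f: "a \<in> carrier A \<Longrightarrow> g (f a) = a [^]\<^bsub>A\<^esub> (p ^ d)"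
    and f_g: "b \<in> carrier B \<Longrightarrow> f (g b) = b [^]\<^bsub>B\<^esub> (p ^ d)"
begin

lemma flipped: "frobenius_inverse_pair B A p g f d"
  by unfold_locales (auto simp: f_g g_f)

lemma degree_pos: "0 < p ^ d"
  using A.prime_p prime_gt_0_nat by simp

lemma frobenius_power_extended_ideal:
  assumes "I \<subseteq> carrier A"
  shows "frobenius_power p B k (extended_ideal B f I)
       = genideal B (f ` (\<lambda>x. x [^]\<^bsub>A\<^esub> (p ^ k)) ` I)"
proof -
  have "f ` I \<subseteq> carrier B" using assms by auto
  then have "frobenius_power p B k (extended_ideal B f I)
      = genideal B ((\<lambda>x. x [^]\<^bsub>B\<^esub> (p ^ k)) ` f ` I)"
    unfolding extended_ideal_def by (rule B.frobenius_power_genideal)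
  also have "(\<lambda>x. x [^]\<^bsub>B\<^esub> (p ^ k)) ` f ` I = f ` (\<lambda>x. x [^]\<^bsub>A\<^esub> (p ^ k)) ` I"
    unfolding image_image using assms by (intro image_cong) (auto simp: f.hom_nat_pow)
  finally show ?thesis .
qed

text \<open>The map \<open>g\<close> brings a membership in \<open>B\<close> back to \<open>A\<close> at the cost of \<open>d\<close> further Frobenius
  powers, because \<open>g \<circ> f\<close> is the \<open>d\<close>-fold Frobenius.\<close>

lemma Fte_le_Fte_extended_ideal:
  assumes I: "I \<subseteq> carrier A"
  shows "Fte p A I \<le> Fte p B (extended_ideal B f I) + enat d"
proof -
  let ?T = "{k. \<forall>y\<in>frobenius_closure p B (extended_ideal B f I).
                  y [^]\<^bsub>B\<^esub> (p ^ k) \<in> frobenius_power p B k (extended_ideal B f I)}"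
  have pow_subset: "(\<lambda>x. x [^]\<^bsub>A\<^esub> (p ^ k)) ` I \<subseteq> carrier A" for k
    using I by auto
  have test: "x [^]\<^bsub>A\<^esub> (p ^ (k + d)) \<in> frobenius_power p A (k + d) I"
    if k: "k \<in> ?T" and x: "x \<in> frobenius_closure p A I" for k x
  proof -
    obtain j where xA: "x \<in> carrier A" and j: "x [^]\<^bsub>A\<^esub> (p ^ j) \<in> frobenius_power p A j I"
      using x unfolding frobenius_closure_def by blast
    have "f (x [^]\<^bsub>A\<^esub> (p ^ j)) \<in> frobenius_power p B j (extended_ideal B f I)"
      unfolding frobenius_power_extended_ideal[OF I]
      using j by (intro f.hom_mem_genideal[OF pow_subset]) (simp add: frobenius_power_def)
    then have "f x \<in> frobenius_closure p B (extended_ideal B f I)"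
      unfolding frobenius_closure_def using xA by (auto simp: f.hom_nat_pow)
    then have "f x [^]\<^bsub>B\<^esub> (p ^ k) \<in> frobenius_power p B k (extended_ideal B f I)"
      using k by blast
    then have "f (x [^]\<^bsub>A\<^esub> (p ^ k)) \<in> genideal B (f ` (\<lambda>x. x [^]\<^bsub>A\<^esub> (p ^ k)) ` I)"
      using xA by (simp add: f.hom_nat_pow frobenius_power_extended_ideal[OF I])
    then have "g (f (x [^]\<^bsub>A\<^esub> (p ^ k))) \<in> genideal A (g ` f ` (\<lambda>x. x [^]\<^bsub>A\<^esub> (p ^ k)) ` I)"
      using pow_subset[of k] by (intro g.hom_mem_genideal) auto
    moreover have g_f_pow: "g (f (z [^]\<^bsub>A\<^esub> (p ^ k))) = z [^]\<^bsub>A\<^esub> (p ^ (k + d))"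
      if "z \<in> carrier A" for z
      using that by (simp add: g_f A.nat_pow_pow power_add)
    moreover have "g ` f ` (\<lambda>x. x [^]\<^bsub>A\<^esub> (p ^ k)) ` I = (\<lambda>x. x [^]\<^bsub>A\<^esub> (p ^ (k + d))) ` I"
      unfolding image_image using I by (intro image_cong) (auto simp: g_f_pow)
    ultimately show ?thesis
      using xA by (simp add: frobenius_power_def)
  qed
  show ?thesis
  proof (cases "Fte p B (extended_ideal B f I)")
    case infinity
    then show ?thesis by simp
  next
    case (enat k)
    then have k: "k \<in> ?T"
      unfolding Fte_def by (rule INF_enat_attained)
    have "Fte p A I \<le> enat (k + d)"
      unfolding Fte_def[of p A I] by (intro INF_lower CollectI ballI test[OF k])
    then show ?thesis by (simp add: enat)
  qed
qed

text \<open>Contraction along \<open>g\<close> is injective on primes because contracting back along \<open>f\<close> gives all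
  \<open>x\<close> with a \<open>p\<close>-power in the prime. So chains of primes of \<open>A\<close> contract to chains of the same
  length in \<open>B\<close>.\<close>

lemma krull_dim_le: "krull_dim A \<le> krull_dim B"
  unfolding krull_dim_def
proof (intro SUP_mono)
  fix n
  assume "n \<in> {n. \<exists>P. (\<forall>i\<le>n. primeideal (P i) A) \<and> (\<forall>i<n. P i \<subset> P (Suc i))}"
  then obtain P where P: "\<And>i. i \<le> n \<Longrightarrow> primeideal (P i) A"
    and chain: "\<And>i. i < n \<Longrightarrow> P i \<subset> P (Suc i)" by blast
  define Q where "Q i = {b \<in> carrier B. g b \<in> P i}" for i
  have "primeideal (Q i) B" if "i \<le> n" for i
    unfolding Q_def using P[OF that] by (intro g.primeideal_vimage B.is_cring)
  moreover have "Q i \<subset> Q (Suc i)" if i: "i < n" for i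
  proof -
    interpret P: primeideal "P i" A using P i by simp
    interpret P': primeideal "P (Suc i)" A using P i by simp
    obtain x where x: "x \<in> P (Suc i)" "x \<notin> P i" using chain[OF i] by blast
    then have xA: "x \<in> carrier A" using P'.Icarr by blast
    have "g (f x) \<in> P (Suc i)"
      using x(1) P'.pow_mem[OF _ degree_pos] by (simp add: g_f xA)
    moreover have "g (f x) \<notin> P i"
      using x(2) P.mem_if_pow_mem[OF xA] by (auto simp: g_f xA)
    ultimately have "f x \<in> Q (Suc i) - Q i"
      using xA by (simp add: Q_def)
    then show ?thesis using chain[OF i] by (auto simp: Q_def)
  qed
  ultimately have "n \<in> {n. \<exists>P. (\<forall>i\<le>n. primeideal (P i) B) \<and> (\<forall>i<n. P i \<subset> P (Suc i))}"
    by blast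
  then show "\<exists>m\<in>{n. \<exists>P. (\<forall>i\<le>n. primeideal (P i) B) \<and> (\<forall>i<n. P i \<subset> P (Suc i))}. enat n \<le> enat m"
    by blast
qed

text \<open>Contraction of a maximal ideal along a ring homomorphism is in general only prime. Here a
  relation \<open>\<one> = c + b\<close> in \<open>B\<close>, with \<open>c \<in> N\<close> and \<open>b\<close> a multiple of \<open>f a\<close>, is carried by \<open>g\<close> to a
  relation between \<open>g c\<close>, which lies in the contraction of \<open>N\<close>, and a multiple of a power of \<open>a\<close>.\<close>

lemma maximalideal_vimage:
  assumes "maximalideal N B"
  shows "maximalideal {a \<in> carrier A. f a \<in> N} A"
proof (intro maximalidealI f.ideal_vimage)
  interpret N: maximalideal N B by fact
  show "ideal N B" by (rule N.is_ideal)
  have "f \<one>\<^bsub>A\<^esub> \<notin> N" using N.one_imp_carrier N.I_notcarr by auto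
  then show "carrier A \<noteq> {a \<in> carrier A. f a \<in> N}" by blast
  fix L
  assume L: "ideal L A" and sub: "{a \<in> carrier A. f a \<in> N} \<subseteq> L" and "L \<subseteq> carrier A"
  interpret L: ideal L A by fact
  show "L = {a \<in> carrier A. f a \<in> N} \<or> L = carrier A"
  proof (rule disjCI)
    assume "L \<noteq> carrier A"
    show "L = {a \<in> carrier A. f a \<in> N}"
    proof (intro equalityI sub subsetI CollectI conjI)
      fix a assume a: "a \<in> L"
      then show aA: "a \<in> carrier A" by (rule L.Icarr)
      show "f a \<in> N"
      proof (rule ccontr)
        assume notin: "f a \<notin> N"
        have fa: "f a \<in> carrier B" using aA by simp
        \<comment> \<open>By maximality of \<open>N\<close> the ideal generated by \<open>N\<close> and \<open>f a\<close> contains \<open>\<one>\<close>, which gives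
          the relation to be carried over.\<close>
        have ideal_sum: "ideal (N <+>\<^bsub>B\<^esub> genideal B {f a}) B"
          using fa by (intro B.add_ideals N.is_ideal B.genideal_ideal) auto
        have mem: "c \<oplus>\<^bsub>B\<^esub> d \<in> N <+>\<^bsub>B\<^esub> genideal B {f a}" if "c \<in> N" "d \<in> genideal B {f a}" for c d
          using that unfolding set_add_def' by blast
        interpret G: ideal "genideal B {f a}" B
          using fa by (intro B.genideal_ideal) auto
        have "N \<subseteq> N <+>\<^bsub>B\<^esub> genideal B {f a}"
          using mem[OF _ G.zero_closed] N.Icarr by fastforce
        moreover have "f a \<in> N <+>\<^bsub>B\<^esub> genideal B {f a}"
          using mem[OF N.zero_closed B.genideal_self'[OF fa]] fa by simp
        ultimately have "N <+>\<^bsub>B\<^esub> genideal B {f a} = carrier B"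
          using N.I_maximal[OF ideal_sum] notin ideal.Icarr[OF ideal_sum] by blast
        then have "\<one>\<^bsub>B\<^esub> \<in> N <+>\<^bsub>B\<^esub> genideal B {f a}" by simp
        then obtain c b where c: "c \<in> N" and b: "b \<in> genideal B {f a}"
          and one: "\<one>\<^bsub>B\<^esub> = c \<oplus>\<^bsub>B\<^esub> b"
          unfolding set_add_def' by blast
        have cB: "c \<in> carrier B" using c by (rule N.Icarr)
        have "f (g c) \<in> N"
          using c N.pow_mem[OF _ degree_pos] by (simp add: f_g cB)
        then have gc: "g c \<in> L" using sub cB by auto
        have "g (f a) \<in> L"
          using a L.pow_mem[OF _ degree_pos] by (simp add: g_f aA)
        then have "genideal A (g ` {f a}) \<subseteq> L"
          by (intro A.genideal_minimal L) auto
        then have "g b \<in> L"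
          using g.hom_mem_genideal[OF _ b] fa by blast
        with gc have "g c \<oplus>\<^bsub>A\<^esub> g b \<in> L" by (rule L.a_closed)
        moreover have "g c \<oplus>\<^bsub>A\<^esub> g b = \<one>\<^bsub>A\<^esub>"
          using one cB G.Icarr[OF b] g.hom_add g.hom_one by metis
        ultimately show False
          using L.one_imp_carrier \<open>L \<noteq> carrier A\<close> by simp
      qed
    qed
  qed
qed

lemma vimage_local:
  assumes "local_ring A M" and "local_ring B N"
  shows "{a \<in> carrier A. f a \<in> N} = M"
  using assms maximalideal_vimage unfolding local_ring_def by blast

end

section \<open>Systems of parameters under extension\<close>

context frobenius_inverse_pair
begin

interpretation flip: frobenius_inverse_pair B A p g f d
  by (rule flipped)

lemma krull_dim_eq: "krull_dim A = krull_dim B"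
  using krull_dim_le flip.krull_dim_le by (rule antisym)

text \<open>If \<open>s\<close> lies in the maximal ideal of \<open>B\<close>, then \<open>g s\<close> lies in that of \<open>A\<close>, so some power of
  \<open>g s\<close> is in the ideal generated by \<open>xs\<close>; applying \<open>f\<close> turns \<open>g s\<close> into a power of \<open>s\<close>.\<close>

lemma system_of_parameters_map:
  assumes A: "local_ring A M" and B: "local_ring B N" and xs: "system_of_parameters A M xs"
  shows "system_of_parameters B N (map f xs)"
  unfolding system_of_parameters_def
proof (intro conjI)
  interpret M: maximalideal M A using A by (simp add: local_ring_def)
  interpret N: maximalideal N B using B by (simp add: local_ring_def)
  interpret prime_N: primeideal N B
    using B.maximalideal_prime N.is_maximalideal by blast
  have xs_M: "set xs \<subseteq> M" and rad: "radical_ideal A (genideal A (set xs)) = M"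
    using xs by (auto simp: system_of_parameters_def)
  have xs_A: "set xs \<subseteq> carrier A" using xs_M M.Icarr by blast
  show fxs_N: "set (map f xs) \<subseteq> N"
    using xs_M vimage_local[OF A B] by auto
  show "enat (length (map f xs)) = krull_dim B"
    using xs by (simp add: system_of_parameters_def krull_dim_eq)
  show "radical_ideal B (genideal B (set (map f xs))) = N"
  proof
    have "genideal B (set (map f xs)) \<subseteq> N"
      by (rule B.genideal_minimal[OF N.is_ideal fxs_N])
    then show "radical_ideal B (genideal B (set (map f xs))) \<subseteq> N"
      unfolding radical_ideal_def using prime_N.mem_if_pow_mem by blast
    show "N \<subseteq> radical_ideal B (genideal B (set (map f xs)))"
    proof
      fix s assume s: "s \<in> N"
      then have sB: "s \<in> carrier B" by (rule N.Icarr)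
      have "g s \<in> M" using flip.vimage_local[OF B A] s by blast
      then obtain n :: nat where n: "g s [^]\<^bsub>A\<^esub> n \<in> genideal A (set xs)"
        using rad unfolding radical_ideal_def by blast
      have "f (g s [^]\<^bsub>A\<^esub> n) = s [^]\<^bsub>B\<^esub> (p ^ d * n)"
        using sB by (simp add: f.hom_nat_pow f_g B.nat_pow_pow)
      moreover have "f (g s [^]\<^bsub>A\<^esub> n) \<in> genideal B (set (map f xs))"
        using f.hom_mem_genideal[OF xs_A n] by simp
      ultimately show "s \<in> radical_ideal B (genideal B (set (map f xs)))"
        using sB unfolding radical_ideal_def by auto
    qed
  qed
qed

lemma parameter_ideal_extended:
  assumes A: "local_ring A M" and B: "local_ring B N" and Q: "parameter_ideal A M Q"
  shows "parameter_ideal B N (extended_ideal B f Q)"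
proof -
  obtain xs ys where sop: "system_of_parameters A M (xs @ ys)" and Q: "Q = genideal A (set xs)"
    using Q by (auto simp: parameter_ideal_def)
  interpret M: maximalideal M A using A by (simp add: local_ring_def)
  have "set xs \<subseteq> carrier A"
    using sop M.Icarr by (auto simp: system_of_parameters_def)
  then have "extended_ideal B f Q = genideal B (set (map f xs))"
    by (simp add: Q extended_ideal_def f.genideal_image_genideal)
  moreover have "system_of_parameters B N (map f xs @ map f ys)"
    using system_of_parameters_map[OF A B sop] by simp
  ultimately show ?thesis
    unfolding parameter_ideal_def by blast
qed

lemma Fte_ring_le:
  assumes A: "local_ring A M" and B: "local_ring B N"
  shows "Fte_ring p A M \<le> Fte_ring p B N + enat d"
  unfolding Fte_ring_def[of p A M]
proof (rule SUP_least)
  fix Q assume "Q \<in> {Q. parameter_ideal A M Q}"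
  then have Q: "parameter_ideal A M Q" by simp
  interpret M: maximalideal M A using A by (simp add: local_ring_def)
  obtain xs where "set xs \<subseteq> carrier A" "Q = genideal A (set xs)"
    using Q M.Icarr by (fastforce simp: parameter_ideal_def system_of_parameters_def)
  then have "Q \<subseteq> carrier A"
    using ideal.Icarr[OF A.genideal_ideal] by blast
  then have "Fte p A Q \<le> Fte p B (extended_ideal B f Q) + enat d"
    by (rule Fte_le_Fte_extended_ideal)
  also have "\<dots> \<le> Fte_ring p B N + enat d"
    unfolding Fte_ring_def using parameter_ideal_extended[OF A B Q]
    by (intro add_right_mono SUP_upper) simp
  finally show "Fte p A Q \<le> Fte_ring p B N + enat d" .
qed

end

section \<open>Purely inseparable extensions\<close>

theorem theorem4p1:
  fixes R :: "('a, 'm) ring_scheme" and S :: "('b, 'n) ring_scheme"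
    and \<phi> :: "'a \<Rightarrow> 'b" and p e\<^sub>0 :: nat
  assumes "cring R" and "noetherian_ring R"
    and "cring S" and "noetherian_ring S"
    and "prime p"
    and "has_characteristic R p" and "has_characteristic S p"
    and "purely_inseparable p R S \<phi>"
    and "pure_insep_index p R S \<phi> = enat e\<^sub>0"
  shows "(\<forall>I J. ideal I R \<longrightarrow> ideal J S \<longrightarrow>
            Fte p R I \<le> Fte p S (extended_ideal S \<phi> I) + enat e\<^sub>0 \<and>
            Fte p S J \<le> Fte p R (frobenius_image_ideal p R S \<phi> e\<^sub>0 J) + enat e\<^sub>0) \<and>
         (\<forall>\<mm> \<nn>. local_ring R \<mm> \<longrightarrow> local_ring S \<nn> \<longrightarrow>
            Fte_ring p R \<mm> \<le> Fte_ring p S \<nn> + enat e\<^sub>0 \<and>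
            Fte_ring p S \<nn> \<le> Fte_ring p R \<mm> + enat e\<^sub>0)"
proof -
  interpret R: prime_char_cring R p
    using assms(1,5,6) unfolding has_characteristic_def
    by (intro prime_char_cring.intro prime_char_cring_axioms.intro) auto
  interpret S: prime_char_cring S p
    using assms(3,5,7) unfolding has_characteristic_def
    by (intro prime_char_cring.intro prime_char_cring_axioms.intro) auto
  have inj: "inj_on \<phi> (carrier R)" and hom: "\<phi> \<in> ring_hom R S"
    using assms(8) unfolding purely_inseparable_def by auto
  interpret \<phi>: ring_hom_ring R S \<phi>
    by (rule ring_hom_ringI2[OF R.ring_axioms S.ring_axioms hom])
  have index: "(\<lambda>s. s [^]\<^bsub>S\<^esub> (p ^ e\<^sub>0)) ` carrier S \<subseteq> \<phi> ` carrier R"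
    using INF_enat_attained[OF assms(9)[unfolded pure_insep_index_def]] by (rule CollectD)
  define \<psi> where "\<psi> s = inv_into (carrier R) \<phi> (s [^]\<^bsub>S\<^esub> (p ^ e\<^sub>0))" for s
  have \<psi>_closed: "\<psi> s \<in> carrier R" and \<phi>_\<psi>: "\<phi> (\<psi> s) = s [^]\<^bsub>S\<^esub> (p ^ e\<^sub>0)"
    if "s \<in> carrier S" for s
  proof -
    have "s [^]\<^bsub>S\<^esub> (p ^ e\<^sub>0) \<in> \<phi> ` carrier R" using index that by blast
    then show "\<psi> s \<in> carrier R" "\<phi> (\<psi> s) = s [^]\<^bsub>S\<^esub> (p ^ e\<^sub>0)"
      unfolding \<psi>_def by (auto intro: inv_into_into f_inv_into_f)
  qed
  have \<psi>_eqI: "\<psi> s = r" if "s \<in> carrier S" "r \<in> carrier R" "\<phi> r = s [^]\<^bsub>S\<^esub> (p ^ e\<^sub>0)" for s r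
    using inj that by (auto intro: inj_onD simp: \<phi>_\<psi> \<psi>_closed)
  \<comment> \<open>By injectivity of \<open>\<phi>\<close>, the homomorphism laws for \<open>\<psi>\<close> follow from those for Frobenius on \<open>S\<close>.\<close>
  interpret F: ring_hom_ring S S "\<lambda>s. s [^]\<^bsub>S\<^esub> (p ^ e\<^sub>0)" by (rule S.frobenius_ring_hom)
  interpret \<psi>: ring_hom_ring S R \<psi>
  proof (intro ring_hom_ringI S.ring_axioms R.ring_axioms)
    fix x y assume xy: "x \<in> carrier S" "y \<in> carrier S"
    show "\<psi> (x \<otimes>\<^bsub>S\<^esub> y) = \<psi> x \<otimes>\<^bsub>R\<^esub> \<psi> y"
      using xy by (intro \<psi>_eqI) (auto simp: \<phi>_\<psi> \<psi>_closed)
    show "\<psi> (x \<oplus>\<^bsub>S\<^esub> y) = \<psi> x \<oplus>\<^bsub>R\<^esub> \<psi> y"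
      using xy by (intro \<psi>_eqI) (auto simp: \<phi>_\<psi> \<psi>_closed)
  next
    show "\<psi> \<one>\<^bsub>S\<^esub> = \<one>\<^bsub>R\<^esub>" by (intro \<psi>_eqI) auto
  qed (rule \<psi>_closed)
  interpret pair: frobenius_inverse_pair R S p \<phi> \<psi> e\<^sub>0
  proof unfold_locales
    show "\<psi> (\<phi> a) = a [^]\<^bsub>R\<^esub> (p ^ e\<^sub>0)" if "a \<in> carrier R" for a
      using that by (intro \<psi>_eqI) (auto simp: \<phi>.hom_nat_pow)
  qed (rule \<phi>_\<psi>)
  interpret flipped_pair: frobenius_inverse_pair S R p \<psi> \<phi> e\<^sub>0
    by (rule pair.flipped)
  have image: "frobenius_image_ideal p R S \<phi> e\<^sub>0 J = extended_ideal R \<psi> J" if "ideal J S" for J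
  proof -
    have JS: "J \<subseteq> carrier S" using ideal.Icarr[OF that] by blast
    have "{r \<in> carrier R. \<exists>y\<in>J. \<phi> r = y [^]\<^bsub>S\<^esub> (p ^ e\<^sub>0)} = \<psi> ` J"
    proof (intro equalityI subsetI)
      fix r assume "r \<in> {r \<in> carrier R. \<exists>y\<in>J. \<phi> r = y [^]\<^bsub>S\<^esub> (p ^ e\<^sub>0)}"
      then obtain y where y: "r \<in> carrier R" "y \<in> J" "\<phi> r = y [^]\<^bsub>S\<^esub> (p ^ e\<^sub>0)" by blast
      then have "\<psi> y = r" using JS by (intro \<psi>_eqI) auto
      then show "r \<in> \<psi> ` J" using y(2) by blast
    next
      fix r assume "r \<in> \<psi> ` J"
      then obtain y where "y \<in> J" "r = \<psi> y" by blast
      then show "r \<in> {r \<in> carrier R. \<exists>y\<in>J. \<phi> r = y [^]\<^bsub>S\<^esub> (p ^ e\<^sub>0)}"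
        using JS \<phi>_\<psi> \<psi>_closed by blast
    qed
    then show ?thesis
      by (simp add: frobenius_image_ideal_def extended_ideal_def)
  qed
  show ?thesis
  proof (intro conjI allI impI)
    fix I J assume I: "ideal I R" and J: "ideal J S"
    show "Fte p R I \<le> Fte p S (extended_ideal S \<phi> I) + enat e\<^sub>0"
      by (intro pair.Fte_le_Fte_extended_ideal subsetI ideal.Icarr[OF I])
    show "Fte p S J \<le> Fte p R (frobenius_image_ideal p R S \<phi> e\<^sub>0 J) + enat e\<^sub>0"
      unfolding image[OF J]
      by (intro flipped_pair.Fte_le_Fte_extended_ideal subsetI ideal.Icarr[OF J])
  next
    fix \<mm> \<nn> assume "local_ring R \<mm>" and "local_ring S \<nn>"
    then show "Fte_ring p R \<mm> \<le> Fte_ring p S \<nn> + enat e\<^sub>0"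
      by (rule pair.Fte_ring_le)
  next
    fix \<mm> \<nn> assume "local_ring R \<mm>" and "local_ring S \<nn>"
    then show "Fte_ring p S \<nn> \<le> Fte_ring p R \<mm> + enat e\<^sub>0"
      by (intro flipped_pair.Fte_ring_le)
  qed
qed

end
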